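(* Let $(r_n)_{n\ge 0}$ be the big Schröder numbers and $(s_n)_{n\ge 0}$ the little Schröder numbers. Both sequences $(r_n)_{n\ge0}$ and $(s_n)_{n\ge0}$ are log-convex. The sequences $(r_n/r_{n-1})_{n\ge 1}$ and $(s_n/s_{n-1})_{n\ge1}$ are increasing and both tend to $3+2\sqrt2$ as $n\to\infty$.
   Context: The $n$-th big Schröder number $r_n$ is the number of lattice paths from $(0,0)$ to $(n,n)$ with steps $(1,0)$, $(0,1)$ and $(1,1)$ that never rise above the line $y=x$; $r_0:=1$. The $n$-th little Schröder number is $s_n=\frac12 r_n$ for $n\ge 1$, and $s_0=1$. A sequence $(a(n))_{n\ge 0}$ of positive real numbers is log-convex if $a(n)^2\le a(n-1)a(n+1)$ for all $n\ge 1$. *)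

theory Defs
  imports Complex_Main
begin

text \<open>A lattice path starting at the origin is the list of its steps; after \<open>k\<close> steps it is at
  the point whose coordinates are the sums of the first \<open>k\<close> steps. Each step is a straight segment,
  so a path never rises above the line \<open>y = x\<close> iff none of its vertices lies above it.\<close>

definition schroeder_paths :: "nat \<Rightarrow> (nat \<times> nat) list set" where
  "schroeder_paths n =
    {p. set p \<subseteq> {(1, 0), (0, 1), (1, 1)} \<and>
        sum_list (map fst p) = n \<and> sum_list (map snd p) = n \<and>
        (\<forall>k \<le> length p. sum_list (map snd (take k p)) \<le> sum_list (map fst (take k p)))}"

definition big_schroeder :: "nat \<Rightarrow> nat" where
  "big_schroeder n = card (schroeder_paths n)"

definition little_schroeder :: "nat \<Rightarrow> real" where
  "little_schroeder n = (if n = 0 then 1 else real (big_schroeder n) / 2)"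

definition log_convex_seq :: "(nat \<Rightarrow> real) \<Rightarrow> bool" where
  "log_convex_seq a \<longleftrightarrow>
    (\<forall>n. a n > 0) \<and> (\<forall>n\<ge>1. (a n)\<^sup>2 \<le> a (n - 1) * a (n + 1))"

lemma length_le_sum_steps:
  assumes "set p \<subseteq> {(1, 0), (0, 1), (1, 1) :: nat \<times> nat}"
  shows "length p \<le> sum_list (map fst p) + sum_list (map snd p)"
  using assms by (induction p) auto

text \<open>In particular the cardinality above is that of a finite set, and the convention that the
  zeroth number is \<open>1\<close> is the value given by the empty path.\<close>

lemma finite_schroeder_paths: "finite (schroeder_paths n)"
proof (rule finite_subset)
  show "schroeder_paths n \<subseteq>
      {p. set p \<subseteq> {(1, 0), (0, 1), (1, 1)} \<and> length p \<le> n + n}"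
  proof
    fix p assume p: "p \<in> schroeder_paths n"
    with length_le_sum_steps[of p] show
      "p \<in> {p. set p \<subseteq> {(1, 0), (0, 1), (1, 1)} \<and> length p \<le> n + n}"
      unfolding schroeder_paths_def mem_Collect_eq by linarith
  qed
  show "finite {p. set p \<subseteq> {(1, 0), (0, 1), (1, 1) :: nat \<times> nat} \<and> length p \<le> n + n}"
    by (rule finite_lists_length_le) simp
qed

lemma big_schroeder_0: "big_schroeder 0 = 1"
proof -
  have "schroeder_paths 0 = {[]}"
  proof (intro equalityI subsetI)
    fix p assume p: "p \<in> schroeder_paths 0"
    with length_le_sum_steps[of p] have "length p \<le> 0"
      unfolding schroeder_paths_def mem_Collect_eq by linarith
    then show "p \<in> {[]}" by simp
  qed (simp add: schroeder_paths_def)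
  then show ?thesis by (simp add: big_schroeder_def)
qed

end

(* Reading a path as a sequence of heights x - y, let g h n count the continuations from height h that
   use n more steps with a horizontal component. Splitting off the first step gives a linear
   recurrence for g that determines it, and the coefficients of R^(h+1) satisfy the same recurrence
   when R = 1 + x R + x R^2; hence R is the generating function of the big Schroeder numbers.
   Completing the square, T = 1 - x - 2 x R satisfies T^2 = 1 - 6 x + x^2, whence
   (1 - 6 x + x^2) T' = (x - 3) T, which is a three-term recurrence for r. In terms of the ratios
   x_n = r_(n+1) / r_n it reads (n+3) x_n x_(n+1) = 3 (2n+3) x_n - n. The property
   (n+3) x_n^2 - 3 (2n+3) x_n + n < 0 is inductive, and says that x_n < x_(n+1). It also gives
   x_n^2 - 6 x_n + 1 < 0, so the ratios are bounded, and the limit is the larger root of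
   L^2 - 6 L + 1 = 0. *)
theory Submission
  imports Defs "HOL-Computational_Algebra.Formal_Power_Series"
begin

section \<open>The generating function\<close>

text \<open>The starting height \<open>h\<close>, the excess of \<open>x\<close> over
  \<open>y\<close>, is free so that removing the first step stays within the family. The total
  \<open>n + h\<close> of vertical steps makes the path end on the diagonal.\<close>

definition paths_from :: "nat \<Rightarrow> nat \<Rightarrow> (nat \<times> nat) list set" where
  "paths_from h n =
    {p. set p \<subseteq> {(1, 0), (0, 1), (1, 1)} \<and>
        sum_list (map fst p) = n \<and> sum_list (map snd p) = n + h \<and>
        (\<forall>k \<le> length p. sum_list (map snd (take k p)) \<le> h + sum_list (map fst (take k p)))}"

lemma schroeder_paths_eq_paths_from: "schroeder_paths n = paths_from 0 n"
  by (simp add: schroeder_paths_def paths_from_def)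

lemma finite_paths_from: "finite (paths_from h n)"
proof (rule finite_subset)
  show "paths_from h n \<subseteq>
      {p. set p \<subseteq> {(1, 0), (0, 1), (1, 1)} \<and> length p \<le> n + (n + h)}"
    unfolding paths_from_def using length_le_sum_steps by fastforce
qed (rule finite_lists_length_le, simp)

lemma Nil_in_paths_from: "[] \<in> paths_from h n \<longleftrightarrow> h = 0 \<and> n = 0"
  by (auto simp: paths_from_def)

lemma all_le_Suc_iff: "(\<forall>k \<le> Suc n. P k) \<longleftrightarrow> P 0 \<and> (\<forall>k \<le> n. P (Suc k))"
  by (metis Suc_le_mono le0 not0_implies_Suc)

lemma Cons_in_paths_from:
  "a # p \<in> paths_from h n \<longleftrightarrow>
     (a = (1, 0) \<and> n > 0 \<and> p \<in> paths_from (Suc h) (n - 1)) \<or>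
     (a = (1, 1) \<and> n > 0 \<and> p \<in> paths_from h (n - 1)) \<or>
     (a = (0, 1) \<and> h > 0 \<and> p \<in> paths_from (h - 1) n)"
proof -
  \<comment> \<open>After a vertical first step, the instance \<open>k = 0\<close> for the tail
    already demands one unit of height.\<close>
  have h0: "h > 0" if "\<forall>k\<le>length p. Suc (sum_list (map snd (take k p)))
      \<le> h + sum_list (map fst (take k p))"
    using that[rule_format, of 0] by simp
  show ?thesis
    unfolding paths_from_def mem_Collect_eq
    by (cases h; cases n) (use h0 in \<open>auto simp: all_le_Suc_iff\<close>)
qed

lemma paths_from_split:
  "paths_from h n =
     (if h = 0 \<and> n = 0 then {[]} else {}) \<union>
     ((if n > 0 then Cons (1, 0) ` paths_from (Suc h) (n - 1) else {}) \<union>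
     ((if n > 0 then Cons (1, 1) ` paths_from h (n - 1) else {}) \<union>
     (if h > 0 then Cons (0, 1) ` paths_from (h - 1) n else {})))" (is "?l = ?r")
proof (rule set_eqI)
  fix p
  show "p \<in> ?l \<longleftrightarrow> p \<in> ?r"
    by (cases p) (auto simp: Nil_in_paths_from Cons_in_paths_from)
qed

lemma card_paths_from:
  "card (paths_from h n) =
     (if h = 0 \<and> n = 0 then 1 else 0) +
     (if n > 0 then card (paths_from (Suc h) (n - 1)) + card (paths_from h (n - 1)) else 0) +
     (if h > 0 then card (paths_from (h - 1) n) else 0)"
  by (subst paths_from_split, subst card_Un_disjoint;
      (subst card_Un_disjoint)?; (subst card_Un_disjoint)?)
     (auto simp: finite_paths_from card_image)

text \<open>The redundant \<open>min k n\<close> lets the termination prover bound the bound variable.\<close>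

fun schroeder_rec :: "nat \<Rightarrow> real" where
  "schroeder_rec 0 = 1"
| "schroeder_rec (Suc n) =
     schroeder_rec n + (\<Sum>k\<in>{0..n}. schroeder_rec (min k n) * schroeder_rec (n - k))"

definition schroeder_fps :: "real fps" where
  "schroeder_fps = Abs_fps schroeder_rec"

lemma schroeder_fps_eq:
  "schroeder_fps = 1 + fps_X * schroeder_fps + fps_X * schroeder_fps ^ 2"
proof (rule fps_ext)
  fix n
  have "fps_nth (schroeder_fps ^ 2) m =
      (\<Sum>k=0..m. schroeder_rec (min k m) * schroeder_rec (m - k))" for m
    by (auto simp: schroeder_fps_def power2_eq_square fps_mult_nth min_def intro!: sum.cong)
  then show "fps_nth schroeder_fps n =
      fps_nth (1 + fps_X * schroeder_fps + fps_X * schroeder_fps ^ 2) n"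
    by (cases n) (simp_all add: schroeder_fps_def)
qed

text \<open>Multiplying the functional equation by \<open>schroeder_fps ^ h\<close> gives the
  first-step recurrence on coefficients. The induction is lexicographic: a horizontal or diagonal
  step lowers \<open>n\<close>, while a vertical one keeps \<open>n\<close> and lowers
  \<open>h\<close>.\<close>

lemma card_paths_from_eq_nth:
  "real (card (paths_from h n)) = fps_nth (schroeder_fps ^ Suc h) n"
proof (induction "(n, h)" arbitrary: n h rule: wf_induct[OF wf_lex_prod[OF wf_less_than wf_less_than]])
  case (1 n h)
  have less: "real (card (paths_from h' n')) = fps_nth (schroeder_fps ^ Suc h') n'"
    if "n' < n \<or> n' = n \<and> h' < h" for n' h'
    using 1 that by auto
  have "schroeder_fps ^ Suc h =
      (1 + fps_X * schroeder_fps + fps_X * schroeder_fps ^ 2) * schroeder_fps ^ h"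
    using schroeder_fps_eq by simp
  also have "\<dots> = schroeder_fps ^ h + fps_X * (schroeder_fps ^ Suc h + schroeder_fps ^ Suc (Suc h))"
    by (simp add: algebra_simps power2_eq_square)
  finally have "fps_nth (schroeder_fps ^ Suc h) n = fps_nth (schroeder_fps ^ h +
      fps_X * (schroeder_fps ^ Suc h + schroeder_fps ^ Suc (Suc h))) n"
    by (rule arg_cong)
  then have *: "fps_nth (schroeder_fps ^ Suc h) n = fps_nth (schroeder_fps ^ h) n +
      (if n = 0 then 0 else fps_nth (schroeder_fps ^ Suc h) (n - 1) +
        fps_nth (schroeder_fps ^ Suc (Suc h)) (n - 1))"
    by (simp only: fps_add_nth fps_X_mult_nth)
  show ?case
    by (subst card_paths_from, subst *, cases h; cases n) (simp_all add: less del: power_Suc)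
qed

lemma big_schroeder_eq_nth: "real (big_schroeder n) = fps_nth schroeder_fps n"
  using card_paths_from_eq_nth[of 0 n]
  by (simp add: big_schroeder_def schroeder_paths_eq_paths_from)

section \<open>The three-term recurrence\<close>

lemma big_schroeder_rec:
  "real (n + 3) * big_schroeder (n + 2) =
     3 * real (2 * n + 3) * big_schroeder (n + 1) - n * big_schroeder n"
proof -
  define T where "T = 1 - fps_X - 2 * fps_X * schroeder_fps"
  define D :: "real fps" where "D = 1 - 6 * fps_X + fps_X ^ 2"
  \<comment> \<open>A polynomial identity in \<open>fps_X\<close> and \<open>schroeder_fps\<close>;
    the bracket vanishes by the functional equation.\<close>
  have "T ^ 2 = D + 4 * fps_X *
      (1 + fps_X * schroeder_fps + fps_X * schroeder_fps ^ 2 - schroeder_fps)"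
    unfolding T_def D_def by algebra
  then have T2: "T ^ 2 = D"
    using schroeder_fps_eq by simp
  have "2 * (T * fps_deriv T) = fps_deriv (T ^ 2)"
    by (simp add: power2_eq_square)
  also have "\<dots> = 2 * (fps_X - 3)"
    unfolding T2 by (simp add: D_def power2_eq_square)
  finally have "T * fps_deriv T = fps_X - 3"
    by (simp only: mult_cancel_left) simp
  then have ode: "D * fps_deriv T = (fps_X - 3) * T"
    by (metis T2 mult.assoc mult.commute power2_eq_square)
  \<comment> \<open>At \<open>k = 0\<close> the summand \<open>- fps_X\<close> of \<open>T\<close>
    would contribute as well.\<close>
  have T_nth: "fps_nth T (Suc k) = - 2 * big_schroeder k" if "k > 0" for k
    using that by (simp add: T_def big_schroeder_eq_nth mult.assoc fps_numeral_fps_const)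
  have "fps_nth (D * fps_deriv T) (n + 2) = fps_nth ((fps_X - 3) * T) (n + 2)"
    using ode by simp
  then have "real (n + 3) * fps_nth T (n + 3) - 6 * real (n + 2) * fps_nth T (n + 2)
      + real (n + 1) * fps_nth T (n + 1) = fps_nth T (n + 1) - 3 * fps_nth T (n + 2)"
    by (simp add: D_def algebra_simps power2_eq_square fps_numeral_fps_const numeral_eq_Suc)
  then show ?thesis
    using T_nth[of "n + 2"] T_nth[of "n + 1"] T_nth[of n]
    \<comment> \<open>The coefficient of \<open>T\<close> at \<open>n + 1\<close> enters with total
      factor \<open>(n + 1) - 1 = n\<close>, so the case \<open>n = 0\<close>, which
      \<open>T_nth\<close> does not cover, drops out.\<close>
    by (cases "n = 0") (simp_all add: numeral_eq_Suc algebra_simps)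
qed

lemma big_schroeder_1: "big_schroeder 1 = 2"
  using big_schroeder_eq_nth[of 1] by (simp add: schroeder_fps_def)

section \<open>The ratios\<close>

definition schroeder_ratio :: "nat \<Rightarrow> real" where
  "schroeder_ratio n = big_schroeder (Suc n) / big_schroeder n"

lemma big_schroeder_pos: "big_schroeder n > 0"
proof -
  have "schroeder_rec n > 0"
  proof (induction n rule: less_induct)
    case (less n)
    then show ?case
      by (cases n) (auto intro!: add_pos_pos sum_pos)
  qed
  then show ?thesis
    using big_schroeder_eq_nth[of n] by (simp add: schroeder_fps_def)
qed

lemma schroeder_ratio_rec:
  "real (n + 3) * (schroeder_ratio n * schroeder_ratio (Suc n)) =
     3 * real (2 * n + 3) * schroeder_ratio n - n"
  using big_schroeder_rec[of n] big_schroeder_pos[of n] big_schroeder_pos[of "Suc n"]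
  by (simp add: schroeder_ratio_def field_simps)

lemma schroeder_ratio_0: "schroeder_ratio 0 = 2"
  using big_schroeder_1 by (simp add: schroeder_ratio_def big_schroeder_0)

text \<open>Serves twice: \<open>x ^ 2 - 6 * x + 1\<close> is the increment of the quadratic when
  \<open>n\<close> grows by one, and its negativity bounds the ratios.\<close>

lemma quadratic_neg_imp:
  fixes x :: real
  assumes "x \<ge> 2" "(real n + 3) * x ^ 2 - 3 * (2 * real n + 3) * x + n \<le> 0"
  shows "x ^ 2 - 6 * x + 1 < 0"
proof -
  have "(real n + 3) * (x ^ 2 - 6 * x + 1) =
      ((real n + 3) * x ^ 2 - 3 * (2 * real n + 3) * x + n) - 3 * (3 * x - 1)"
    by (simp add: algebra_simps)
  also have "\<dots> < 0"
  proof -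
    have "0 < 3 * (3 * x - 1)"
      using assms(1) by simp
    from le_less_trans[OF assms(2) this] show ?thesis
      by (simp only: diff_less_0_iff_less)
  qed
  finally have "(real n + 3) * (x ^ 2 - 6 * x + 1) < 0" .
  then show ?thesis
    by (simp add: mult_less_0_iff)
qed

lemma schroeder_ratio_invariant:
  "schroeder_ratio n \<ge> 2 \<and>
   (real n + 3) * schroeder_ratio n ^ 2 - 3 * (2 * real n + 3) * schroeder_ratio n + n < 0 \<and>
   schroeder_ratio n < schroeder_ratio (Suc n)"
proof (induction n)
  \<comment> \<open>The recurrence turns negativity of the quadratic at \<open>x\<close> into
    \<open>(n + 3) * x ^ 2 < (n + 3) * x * y\<close>.\<close>
  have step: "x < y"
    if "x \<ge> 2" "(real n + 3) * x ^ 2 - 3 * (2 * real n + 3) * x + n < 0"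
      "(real n + 3) * (x * y) = 3 * (2 * real n + 3) * x - n" for x y :: real and n
  proof -
    have "(real n + 3) * x * x < (real n + 3) * x * y"
      using that by (simp add: power2_eq_square mult.assoc)
    then show ?thesis
      using that by (simp add: mult_less_cancel_left_pos)
  qed
  have rec: "(real n + 3) * (schroeder_ratio n * schroeder_ratio (Suc n)) =
      3 * (2 * real n + 3) * schroeder_ratio n - n" for n
    using schroeder_ratio_rec[of n] by (simp add: add.commute)
  {
    case 0
    show ?case
      using step[of "schroeder_ratio 0" 0] rec[of 0] by (simp add: schroeder_ratio_0)
  next
    case (Suc n)
    define x y where "x = schroeder_ratio n" and "y = schroeder_ratio (Suc n)"
    let ?q = "(real n + 3) * y ^ 2 - 3 * (2 * real n + 3) * y + n"
    have x: "x \<ge> 2" "x < y" and y: "y \<ge> 2"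
      using Suc by (auto simp: x_def y_def)
    \<comment> \<open>Eliminating \<open>x * y\<close> by the recurrence leaves only this. It is
      zero for \<open>n = 0\<close>, so strictness has to come from the increment below.\<close>
    have "x * ?q = real n * (x - y)"
      using rec[of n, folded x_def y_def] by algebra
    also have "\<dots> \<le> 0"
      using x by (simp add: mult_nonneg_nonpos)
    finally have "?q \<le> 0"
      using x by (simp add: mult_le_0_iff)
    then have "?q + (y ^ 2 - 6 * y + 1) < 0"
      using quadratic_neg_imp[OF y, of n] by linarith
    then have "(real (Suc n) + 3) * y ^ 2 - 3 * (2 * real (Suc n) + 3) * y + Suc n < 0"
      by (simp add: algebra_simps)
    then show ?case
      using step[OF y _ rec[of "Suc n", folded y_def]] y by (simp add: y_def)
  }
qed

lemma strict_mono_schroeder_ratio: "strict_mono schroeder_ratio"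
  using schroeder_ratio_invariant by (auto simp: strict_mono_Suc_iff)

lemma schroeder_ratio_tendsto: "schroeder_ratio \<longlonglongrightarrow> 3 + 2 * sqrt 2"
proof -
  let ?x = schroeder_ratio
  have "?x n \<le> 6" for n
  proof -
    have "?x n ^ 2 - 6 * ?x n + 1 < 0" "?x n \<ge> 2"
      using quadratic_neg_imp[of "?x n" n] schroeder_ratio_invariant[of n] by auto
    then have "?x n * ?x n \<le> 6 * ?x n" "?x n > 0"
      unfolding power2_eq_square by linarith+
    then show ?thesis
      by simp
  qed
  then obtain L where L: "?x \<longlonglongrightarrow> L"
    using incseq_convergent[of ?x 6] strict_mono_mono[OF strict_mono_schroeder_ratio] by blast
  \<comment> \<open>Dividing the recurrence by \<open>n + 3\<close> exhibits the coefficients as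
    constants plus null sequences.\<close>
  have eq: "?x n * ?x (Suc n) = (6 - 9 / real (n + 3)) * ?x n - (1 - 3 / real (n + 3))" for n
  proof -
    have "6 - 9 / real (n + 3) = 3 * real (2 * n + 3) / real (n + 3)"
      "1 - 3 / real (n + 3) = real n / real (n + 3)"
      by (simp_all add: field_simps)
    moreover have "?x n * ?x (Suc n) = (3 * real (2 * n + 3) * ?x n - n) / real (n + 3)"
      unfolding schroeder_ratio_rec[symmetric] by simp
    ultimately show ?thesis
      by (simp only: diff_divide_distrib times_divide_eq_left)
  qed
  have inv: "(\<lambda>n. c / real (n + 3)) \<longlonglongrightarrow> 0" for c :: real
    using LIMSEQ_ignore_initial_segment[OF lim_const_over_n] .
  have "(\<lambda>n. (6 - 9 / real (n + 3)) * ?x n - (1 - 3 / real (n + 3)))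
      \<longlonglongrightarrow> (6 - 0) * L - (1 - 0)"
    by (intro tendsto_intros inv L)
  moreover have "(\<lambda>n. ?x n * ?x (Suc n)) \<longlonglongrightarrow> L * L"
    by (intro tendsto_intros L LIMSEQ_Suc)
  ultimately have "L * L = 6 * L - 1"
    unfolding eq using LIMSEQ_unique by fastforce
  then have "(L - 3)\<^sup>2 = (2 * sqrt 2)\<^sup>2"
    by (simp add: power2_eq_square algebra_simps)
  \<comment> \<open>Excludes the smaller root \<open>3 - 2 * sqrt 2\<close>, which is at most
    1.\<close>
  moreover have "L \<ge> 2"
    using LIMSEQ_le_const[OF L] schroeder_ratio_invariant by blast
  moreover have "sqrt 2 \<ge> 1"
    by simp
  ultimately have "L = 3 + 2 * sqrt 2"
    unfolding power2_eq_iff by linarith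
  with L show ?thesis
    by simp
qed

theorem theorem4p3:
  "log_convex_seq (\<lambda>n. real (big_schroeder n)) \<and>
    log_convex_seq little_schroeder \<and>
    strict_mono_on {1..} (\<lambda>n. real (big_schroeder n) / real (big_schroeder (n - 1))) \<and>
    strict_mono_on {1..} (\<lambda>n. little_schroeder n / little_schroeder (n - 1)) \<and>
    (\<lambda>n. real (big_schroeder n) / real (big_schroeder (n - 1))) \<longlonglongrightarrow> 3 + 2 * sqrt 2 \<and>
    (\<lambda>n. little_schroeder n / little_schroeder (n - 1)) \<longlonglongrightarrow> 3 + 2 * sqrt 2"
proof -
  let ?r = "\<lambda>n. real (big_schroeder n)" and ?s = little_schroeder
  have convexI: "log_convex_seq a"
    if "\<And>n. a n > 0" "\<And>n. a (Suc n) / a n \<le> a (Suc (Suc n)) / a (Suc n)" for a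
    unfolding log_convex_seq_def
  proof (intro conjI allI impI)
    fix n :: nat
    assume "n \<ge> 1"
    then obtain m where "n = Suc m"
      by (cases n) auto
    then show "(a n)\<^sup>2 \<le> a (n - 1) * a (n + 1)"
      using that(1)[of m] that(1)[of "Suc m"] that(2)[of m]
      by (simp add: field_simps power2_eq_square)
  qed (rule that(1))
  have mono_onI: "strict_mono_on {1..} (\<lambda>n. a n / a (n - 1))"
    if "strict_mono (\<lambda>n. a (Suc n) / a n)" for a :: "nat \<Rightarrow> real"
  proof (rule strict_mono_onI)
    fix m n :: nat
    assume "m \<in> {1..}" "n \<in> {1..}" "m < n"
    then show "a m / a (m - 1) < a n / a (n - 1)"
      using strict_monoD[OF that, of "m - 1" "n - 1"] by simp
  qed
  have r: "(\<lambda>n. ?r (Suc n) / ?r n) = schroeder_ratio"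
    by (simp add: schroeder_ratio_def fun_eq_iff)
  \<comment> \<open>Since \<open>?s 0\<close> is 1 and not half of \<open>?r 0\<close>, the first
    ratio is 1 instead of 2. It still lies below all later ones, which are at least 2.\<close>
  have s: "?s (Suc n) / ?s n = (if n = 0 then 1 else schroeder_ratio n)" for n
    using big_schroeder_1 by (simp add: little_schroeder_def schroeder_ratio_def)
  have s_mono: "strict_mono (\<lambda>n. ?s (Suc n) / ?s n)"
    unfolding strict_mono_Suc_iff s
    using schroeder_ratio_invariant by (auto intro: less_le_trans[of _ 2])
  have s_lim: "(\<lambda>n. ?s (Suc n) / ?s n) \<longlonglongrightarrow> 3 + 2 * sqrt 2"
  \<comment> \<open>Shifting the index skips the exceptional first ratio.\<close>
  proof (rule LIMSEQ_imp_Suc)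
    show "(\<lambda>n. ?s (Suc (Suc n)) / ?s (Suc n)) \<longlonglongrightarrow> 3 + 2 * sqrt 2"
      unfolding s using LIMSEQ_Suc[OF schroeder_ratio_tendsto] by simp
  qed
  show ?thesis
  proof (intro conjI)
    show "log_convex_seq ?r"
      using schroeder_ratio_invariant
      by (intro convexI) (auto simp: big_schroeder_pos schroeder_ratio_def less_imp_le)
    show "log_convex_seq ?s"
      using s_mono
      by (intro convexI) (auto simp: little_schroeder_def big_schroeder_pos strict_mono_Suc_iff less_imp_le)
    show "strict_mono_on {1..} (\<lambda>n. ?r n / ?r (n - 1))"
      using strict_mono_schroeder_ratio by (intro mono_onI) (simp add: r)
    show "strict_mono_on {1..} (\<lambda>n. ?s n / ?s (n - 1))"
      using s_mono by (rule mono_onI)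
    show "(\<lambda>n. ?r n / ?r (n - 1)) \<longlonglongrightarrow> 3 + 2 * sqrt 2"
      by (rule LIMSEQ_imp_Suc) (simp add: r schroeder_ratio_tendsto)
    show "(\<lambda>n. ?s n / ?s (n - 1)) \<longlonglongrightarrow> 3 + 2 * sqrt 2"
      by (rule LIMSEQ_imp_Suc) (simp add: s_lim)
  qed
qed

end
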